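(* Let $D<0$ be an integer with $D\equiv0\pmod4$. There exist integers $a,b$ with $$D=b^2-4a^2,\qquad |b|\leqslant a,\qquad \gcd(a,b)=1$$ if and only if $D/4$ factors as $D/4=-FG$ with $F,G$ positive integers such that $\frac{F+G}{2}$ is an integer, $$\frac13\leqslant\frac FG\leqslant3\quad\text{and}\quad \gcd\left(\tfrac{F+G}{2},\,2G\right)=1.$$ *)

theory Defs
  imports Complex_Main "HOL-Number_Theory.Cong"
begin

end

theory Submission
  imports Defs
begin

text \<open>
  Since \<open>4 dvd D\<close>, any such \<open>b\<close> is even, say \<open>b = 2 * c\<close>, and \<open>D div 4 = c\<^sup>2 - a\<^sup>2\<close>. The two sides
  correspond under \<open>F = a + c\<close>, \<open>G = a - c\<close>: the bound on \<open>F / G\<close> says \<open>\<bar>2 * c\<bar> \<le> a\<close>, and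
  \<open>gcd a (2 * G) = gcd a (2 * a - 2 * c) = gcd a b\<close>.
\<close>

text \<open>Modulo \<open>a\<close> the second argument is \<open>- (2 * c)\<close>, and a gcd
  ignores signs.\<close>

lemma gcd_double_diff: "gcd a (2 * (a - c)) = gcd a (2 * c)" for a c :: int
proof -
  have "2 * (a - c) = 2 * a + - (2 * c)" by simp
  then show ?thesis by (metis gcd_add_mult gcd_neg2 mult.commute)
qed

text \<open>Clearing the positive denominator turns the real bounds into linear integer inequalities
  in \<open>a\<close> and \<open>c\<close>.\<close>

lemma ratio_bounds_iff:
  fixes F G :: int
  assumes "G > 0"
  shows "1 / 3 \<le> real_of_int F / real_of_int G \<and> real_of_int F / real_of_int G \<le> 3
    \<longleftrightarrow> G \<le> 3 * F \<and> F \<le> 3 * G"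
  using assms by (simp add: field_simps) linarith

theorem proposition13:
  fixes D :: int
  assumes "D < 0" and "[D = 0] (mod 4)"
  shows "(\<exists>a b :: int. D = b\<^sup>2 - 4 * a\<^sup>2 \<and> \<bar>b\<bar> \<le> a \<and> gcd a b = 1) \<longleftrightarrow>
    (\<exists>F G :: int. F > 0 \<and> G > 0 \<and> D div 4 = - (F * G) \<and> 2 dvd (F + G) \<and>
      1 / 3 \<le> real_of_int F / real_of_int G \<and> real_of_int F / real_of_int G \<le> 3 \<and>
      gcd ((F + G) div 2) (2 * G) = 1)" (is "?L \<longleftrightarrow> ?R")
proof
  assume ?L
  then obtain a b where D: "D = b\<^sup>2 - 4 * a\<^sup>2" and ab: "\<bar>b\<bar> \<le> a" and g: "gcd a b = 1"
    by (elim exE conjE)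
  have "4 dvd D" using assms(2) by (simp add: cong_0_iff)
  then have "4 dvd D + 4 * a\<^sup>2" by simp
  then have "4 dvd b\<^sup>2" using D by simp
  then have "even (b\<^sup>2)" by (rule dvd_trans[rotated]) simp
  then obtain c where c: "b = 2 * c" by (auto elim: evenE)
  \<comment> \<open>If \<open>a = 0\<close>, then \<open>b = 0\<close> and hence
    \<open>D = 0\<close>. So \<open>a > 0\<close>, and \<open>2 * \<bar>c\<bar> \<le> a\<close>
    yields the strict bound \<open>\<bar>c\<bar> < a\<close> that makes both factors
    positive.\<close>
  have "a \<noteq> 0" using assms(1) D ab by auto
  then have pos: "a + c > 0" "a - c > 0" using ab c by linarith+
  have bounds: "a - c \<le> 3 * (a + c)" "a + c \<le> 3 * (a - c)" using ab c by (simp_all add: abs_le_iff)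
  have "D = 4 * - ((a + c) * (a - c))" unfolding D c by (simp add: algebra_simps power2_eq_square)
  then have "D div 4 = - ((a + c) * (a - c))" by simp
  moreover have "2 dvd a + c + (a - c)" by simp
  moreover have "(a + c + (a - c)) div 2 = a" by simp
  then have "gcd ((a + c + (a - c)) div 2) (2 * (a - c)) = 1"
    using g unfolding c by (simp only: gcd_double_diff)
  moreover have "1 / 3 \<le> real_of_int (a + c) / real_of_int (a - c) \<and>
      real_of_int (a + c) / real_of_int (a - c) \<le> 3"
    using bounds ratio_bounds_iff[OF pos(2)] by metis
  ultimately show ?R
    using pos by (elim conjE, intro exI conjI)
next
  assume ?R
  then obtain F G where pos: "F > 0" "G > 0" and D: "D div 4 = - (F * G)" and ev: "2 dvd F + G"
    and r: "1 / 3 \<le> real_of_int F / real_of_int G \<and> real_of_int F / real_of_int G \<le> 3"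
    and g: "gcd ((F + G) div 2) (2 * G) = 1" by (elim exE conjE) (rule that; (rule conjI)?; assumption)
  have bounds: "G \<le> 3 * F" "F \<le> 3 * G" using r ratio_bounds_iff[OF pos(2)] by blast+
  from ev obtain a where a: "F + G = 2 * a" by blast
  \<comment> \<open>This is half of \<open>F - G\<close>, an integer because \<open>F + G\<close> is
    even; the witnesses for \<open>?L\<close> are \<open>a\<close> and \<open>2 * c\<close>.\<close>
  define c where "c = a - G"
  have G: "G = a - c" and F: "F = a + c" using a by (simp_all add: c_def)
  have "4 dvd D" using assms(2) by (simp add: cong_0_iff)
  \<comment> \<open>Divisibility by 4 makes \<open>D div 4\<close> exact, so \<open>D\<close> is
    recovered from it.\<close>
  then have "D = 4 * - (F * G)" using D dvd_mult_div_cancel[of 4 D] by simp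
  then have "D = (2 * c)\<^sup>2 - 4 * a\<^sup>2"
    by (simp add: F G algebra_simps power2_eq_square)
  moreover have "\<bar>2 * c\<bar> \<le> a" using bounds F G by linarith
  moreover have "gcd a (2 * c) = 1" using g gcd_double_diff[of a c] unfolding a G[symmetric] by simp
  ultimately show ?L by (intro exI conjI)
qed

end
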